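(* There does not exist a (single, deterministic) algorithm guaranteeing rendezvous for every synchronous instance $(r,x,y,\phi,\tau,v,t,\chi)$ (i.e. $\tau=v=1$) such that $\chi=-1$ and $t=\mathrm{dist}(proj_A,proj_B)-r$.
   Context: Model. Two agents $A$ and $B$ are points moving in the plane. Everything is expressed in the system of agent $A$: its Cartesian coordinate system (origin at its start point), time unit, length unit, speed $1$, wake-up at time $0$. An instance is a tuple $(r,x,y,\phi,\tau,v,t,\chi)$: $r>0$ visibility radius; $(x,y)\neq(0,0)$ initial position of $B$; $0\le\phi<2\pi$ the counterclockwise angle from $A$'s $x$-axis to $B$'s $x$-axis; $\chi=+1$ if $B$'s $y$-axis points in direction $\phi+\pi/2$ and $-1$ if it points in direction $\phi-\pi/2$; $\tau>0$ duration of $B$'s time unit; $v>0$ speed of $B$; $t\ge0$ wake-up time of $B$ (idle at its initial position before). $B$'s length unit is $\tau v$. Both agents execute the same deterministic algorithm, a (possibly infinite) sequence of instructions "go in direction $\theta$ (private coordinates) a distance $d$ (private length units)" and "wait $z$ private time units", whose behaviour may depend only on the algorithm, private clock/coordinates and whether the other agent has been sensed within distance $r$; the algorithm does not know the instance. Rendezvous occurs when the agents are at distance at most $r$ and never move afterwards. The canonical line $L$ is the line through the midpoint of $(0,0)$ and $(x,y)$ making angle $\phi/2$ with $A$'s $x$-axis. $proj_A$, $proj_B$ are the orthogonal projections on $L$ of the initial positions of $A$, $B$; $\mathrm{dist}$ is Euclidean distance. *)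

theory Defs
  imports "HOL-Analysis.Analysis"
begin

text \<open>
  The plane is the type of complex numbers.  Absolute positions and times are those of agent A.
  Every agent measures lengths in units of (its time unit) times (its speed), so in private
  units every agent moves with speed 1, and going a distance d takes d private time units.
\<close>

datatype instruction =
    Go (direction: real) (amount: real)
  | Wait (amount: real)

datatype program = Finite_Program "instruction list" | Infinite_Program "nat \<Rightarrow> instruction"

text \<open>A finite program is continued by waits of length 0, which take no time and never move.\<close>

fun nth_instruction :: "program \<Rightarrow> nat \<Rightarrow> instruction" where
  "nth_instruction (Finite_Program is) k = (if k < length is then is ! k else Wait 0)"
| "nth_instruction (Infinite_Program f) k = f k"

definition valid_program :: "program \<Rightarrow> bool" where
  "valid_program P \<longleftrightarrow> (\<forall>k. 0 \<le> amount (nth_instruction P k))"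

fun velocity :: "instruction \<Rightarrow> complex" where
  "velocity (Go \<theta> d) = cis \<theta>"
| "velocity (Wait z) = 0"

definition start_time :: "program \<Rightarrow> nat \<Rightarrow> real" where
  "start_time P k = (\<Sum>i<k. amount (nth_instruction P i))"

text \<open>The time spent on the k-th instruction up to private time s.\<close>

definition time_spent :: "program \<Rightarrow> nat \<Rightarrow> real \<Rightarrow> real" where
  "time_spent P k s = max 0 (min (amount (nth_instruction P k)) (s - start_time P k))"

text \<open>
  The series converges for every valid program (lemma \<open>summable_displacement\<close>).  At times
  \<open>s \<le> 0\<close> the displacement is 0.  If infinitely many instructions have finite total
  duration, the agent stays at the limit point once that duration has elapsed.
\<close>

definition displacement :: "program \<Rightarrow> real \<Rightarrow> complex" where
  "displacement P s = (\<Sum>k. time_spent P k s *\<^sub>R velocity (nth_instruction P k))"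

text \<open>
  The only input of an agent is whether, and since when on its private clock, the other agent has
  been sensed.  Hence an algorithm consists of the program executed as long as the other agent has
  not been sensed, and, for every private time \<open>\<sigma>\<close>, the program to which the agent switches
  (interrupting the current instruction) if it senses the other agent for the first time at
  \<open>\<sigma>\<close>.  The private position of the agent at \<open>\<sigma>\<close> is a function of \<open>\<sigma>\<close>.
\<close>

record algorithm =
  search :: program
  react :: "real \<Rightarrow> program"

definition valid_algorithm :: "algorithm \<Rightarrow> bool" where
  "valid_algorithm alg \<longleftrightarrow> valid_program (search alg) \<and> (\<forall>\<sigma>\<ge>0. valid_program (react alg \<sigma>))"

text \<open>
  Position in private coordinates at private time s; the second argument is the private time of
  the first sensing of the other agent, if any.
\<close>

fun private_position :: "algorithm \<Rightarrow> real option \<Rightarrow> real \<Rightarrow> complex" where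
  "private_position alg None s = displacement (search alg) s"
| "private_position alg (Some \<sigma>) s =
    (if s \<le> \<sigma> then displacement (search alg) s
     else displacement (search alg) \<sigma> + displacement (react alg \<sigma>) (s - \<sigma>))"

text \<open>The tuple \<open>(r, x, y, \<phi>, \<tau>, v, t, \<chi>)\<close>.\<close>

record rv_instance =
  radius :: real
  init_x :: real
  init_y :: real
  angle :: real
  time_unit :: real
  speed :: real
  wakeup :: real
  chirality :: int

definition valid_instance :: "rv_instance \<Rightarrow> bool" where
  "valid_instance I \<longleftrightarrow>
     0 < radius I \<and> (init_x I, init_y I) \<noteq> (0, 0) \<and> 0 \<le> angle I \<and> angle I < 2 * pi \<and>
     0 < time_unit I \<and> 0 < speed I \<and> 0 \<le> wakeup I \<and> chirality I \<in> {1, -1}"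

definition synchronous :: "rv_instance \<Rightarrow> bool" where
  "synchronous I \<longleftrightarrow> time_unit I = 1 \<and> speed I = 1"

definition init_B :: "rv_instance \<Rightarrow> complex" where
  "init_B I = Complex (init_x I) (init_y I)"

definition private_time_B :: "rv_instance \<Rightarrow> real \<Rightarrow> real" where
  "private_time_B I s = (s - wakeup I) / time_unit I"

text \<open>
  Absolute positions at absolute time s, given the private time of the first sensing (if any).
  Before its wake-up the private time of B is negative, and B is at its initial position.
\<close>

definition position_A :: "algorithm \<Rightarrow> real option \<Rightarrow> real \<Rightarrow> complex" where
  "position_A alg \<sigma> s = private_position alg \<sigma> s"

definition position_B :: "rv_instance \<Rightarrow> algorithm \<Rightarrow> real option \<Rightarrow> real \<Rightarrow> complex" where
  "position_B I alg \<sigma> s =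
    (let z = private_position alg \<sigma> (private_time_B I s)
     in init_B I + (time_unit I * speed I) *\<^sub>R
          (Re z *\<^sub>R cis (angle I) + Im z *\<^sub>R cis (angle I + of_int (chirality I) * pi / 2)))"

definition first_time :: "real set \<Rightarrow> real option" where
  "first_time S = (if S = {} then None else Some (Inf S))"

text \<open>
  A senses from time 0 on, also while B is still asleep; B senses from its wake-up on.  Whenever B
  senses A, A senses B as well, so until its own first sensing A faces a B that still executes
  its search program; B in turn faces an A that may have sensed B already while B was asleep.
\<close>

definition sensing_A :: "rv_instance \<Rightarrow> algorithm \<Rightarrow> real option" where
  "sensing_A I alg =
     first_time {s. 0 \<le> s \<and> dist (position_A alg None s) (position_B I alg None s) \<le> radius I}"

definition sensing_B :: "rv_instance \<Rightarrow> algorithm \<Rightarrow> real option" where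
  "sensing_B I alg = map_option (private_time_B I)
     (first_time {s. wakeup I \<le> s \<and>
        dist (position_A alg (sensing_A I alg) s) (position_B I alg None s) \<le> radius I})"

definition trajectory_A :: "rv_instance \<Rightarrow> algorithm \<Rightarrow> real \<Rightarrow> complex" where
  "trajectory_A I alg = position_A alg (sensing_A I alg)"

definition trajectory_B :: "rv_instance \<Rightarrow> algorithm \<Rightarrow> real \<Rightarrow> complex" where
  "trajectory_B I alg = position_B I alg (sensing_B I alg)"

definition rendezvous :: "algorithm \<Rightarrow> rv_instance \<Rightarrow> bool" where
  "rendezvous alg I \<longleftrightarrow>
     (\<exists>s\<^sub>0\<ge>0. dist (trajectory_A I alg s\<^sub>0) (trajectory_B I alg s\<^sub>0) \<le> radius I \<and>
        (\<forall>s\<ge>s\<^sub>0. trajectory_A I alg s = trajectory_A I alg s\<^sub>0 \<and>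
                 trajectory_B I alg s = trajectory_B I alg s\<^sub>0))"

definition canonical_line :: "rv_instance \<Rightarrow> complex set" where
  "canonical_line I = range (\<lambda>c::real. midpoint 0 (init_B I) + c *\<^sub>R cis (angle I / 2))"

definition orthogonal_projection :: "complex set \<Rightarrow> complex \<Rightarrow> complex" where
  "orthogonal_projection L p = (THE q. q \<in> L \<and> (\<forall>z\<in>L. orthogonal (p - q) (z - q)))"

definition proj_A :: "rv_instance \<Rightarrow> complex" where
  "proj_A I = orthogonal_projection (canonical_line I) 0"

definition proj_B :: "rv_instance \<Rightarrow> complex" where
  "proj_B I = orthogonal_projection (canonical_line I) (init_B I)"

lemma orthogonal_projection_canonical_line:
  "orthogonal_projection (canonical_line I) p =
     midpoint 0 (init_B I) +
     ((p - midpoint 0 (init_B I)) \<bullet> cis (angle I / 2)) *\<^sub>R cis (angle I / 2)"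
proof -
  define m where "m = midpoint 0 (init_B I)"
  define u where "u = cis (angle I / 2)"
  have uu: "u \<bullet> u = 1"
    by (simp add: u_def dot_square_norm)
  have L: "canonical_line I = range (\<lambda>c::real. m + c *\<^sub>R u)"
    by (simp add: canonical_line_def m_def u_def)
  let ?q = "m + ((p - m) \<bullet> u) *\<^sub>R u"
  have "orthogonal_projection (canonical_line I) p = ?q"
    unfolding orthogonal_projection_def
  proof (rule the_equality)
    show "?q \<in> canonical_line I \<and> (\<forall>z\<in>canonical_line I. orthogonal (p - ?q) (z - ?q))"
    proof (intro conjI ballI)
      show "?q \<in> canonical_line I" unfolding L by (rule rangeI)
      fix z assume "z \<in> canonical_line I"
      then obtain c where "z = m + c *\<^sub>R u" by (auto simp: L)
      then have z: "z - ?q = (c - (p - m) \<bullet> u) *\<^sub>R u" by (simp add: algebra_simps)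
      have "(p - ?q) \<bullet> u = 0" by (simp add: uu inner_simps)
      then show "orthogonal (p - ?q) (z - ?q)" unfolding z orthogonal_def by simp
    qed
  next
    fix q assume q: "q \<in> canonical_line I \<and> (\<forall>z\<in>canonical_line I. orthogonal (p - q) (z - q))"
    then obtain c where c: "q = m + c *\<^sub>R u" by (auto simp: L)
    have "m + (c + 1) *\<^sub>R u \<in> canonical_line I" by (auto simp: L)
    with q have "orthogonal (p - q) (m + (c + 1) *\<^sub>R u - q)" by blast
    moreover have "m + (c + 1) *\<^sub>R u - q = u" by (simp add: c algebra_simps)
    ultimately have "(p - q) \<bullet> u = 0" by (simp add: orthogonal_def)
    then have "c = (p - m) \<bullet> u" by (simp add: c uu inner_simps algebra_simps)
    then show "q = ?q" by (simp add: c)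
  qed
  then show ?thesis by (simp add: m_def u_def)
qed

lemma sum_time_spent:
  assumes "valid_program P" "0 \<le> s"
  shows "(\<Sum>k<n. time_spent P k s) = min s (start_time P n)"
proof (induction n)
  case 0
  then show ?case using assms by (simp add: start_time_def)
next
  case (Suc n)
  have "0 \<le> amount (nth_instruction P n)" using assms by (simp add: valid_program_def)
  moreover have "start_time P (Suc n) = start_time P n + amount (nth_instruction P n)"
    by (simp add: start_time_def)
  ultimately show ?case using Suc by (simp add: time_spent_def min_def max_def)
qed

lemma displacement_nonpos:
  assumes "valid_program P" "s \<le> 0"
  shows "displacement P s = 0"
proof -
  have "0 \<le> start_time P k" for k
    using assms by (auto simp: start_time_def valid_program_def intro: sum_nonneg)
  then have "time_spent P k s = 0" for k
    using assms(2) by (smt (verit) time_spent_def)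
  then show ?thesis by (simp add: displacement_def)
qed

lemma summable_displacement:
  assumes "valid_program P" "0 \<le> s"
  shows "summable (\<lambda>k. time_spent P k s *\<^sub>R velocity (nth_instruction P k))"
proof (rule summable_comparison_test)
  have "norm (velocity i) \<le> 1" for i by (cases i) auto
  then show "\<exists>N. \<forall>k\<ge>N. norm (time_spent P k s *\<^sub>R velocity (nth_instruction P k)) \<le> time_spent P k s"
    by (auto simp: time_spent_def intro!: mult_left_le)
  show "summable (\<lambda>k. time_spent P k s)"
  proof (rule bounded_imp_summable[where B = s])
    show "0 \<le> time_spent P k s" for k by (simp add: time_spent_def)
    show "(\<Sum>k\<le>n. time_spent P k s) \<le> s" for n
      using sum_time_spent[OF assms, of "Suc n"] by (simp add: lessThan_Suc_atMost)
  qed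
qed

end

(* The wake-up delay is exactly what B must lose in order to come within distance r: along the
   canonical line the agents start at distance t + r, and, as both perform mirrored copies of the same
   moves with delay t, this component of their distance shrinks at time s by the progress that A's
   path makes along the line between times s - t and s. At speed 1 this progress is at most t, with
   equality only if A moves exactly in the direction of the line for the whole duration t. An
   algorithm uses countably many directions before the first sensing, so for some angle none of them
   is the direction of the line, and the agents never sense each other. *)

theory Submission imports Defs begin

text \<open>This is the equality case of Cauchy-Schwarz. Allowing \<open>norm v < 1\<close> covers
  waits, whose velocity is 0.\<close>

lemma inner_less_one:
  fixes u v :: "'a::real_inner"
  assumes "norm u = 1" "norm v \<le> 1" "v \<noteq> u"
  shows "v \<bullet> u < 1"
proof -
  have "0 < (norm (v - u))\<^sup>2" using assms(3) by simp
  also have "(norm (v - u))\<^sup>2 = (norm v)\<^sup>2 - 2 * (v \<bullet> u) + 1"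
    using assms(1) by (simp add: power2_norm_eq_inner norm_eq_1 inner_simps inner_commute)
  also have "(norm v)\<^sup>2 \<le> 1" using assms(2) by (simp add: power_le_one)
  finally show ?thesis by simp
qed

lemma norm_velocity_le: "norm (velocity i) \<le> 1"
  by (cases i) auto

lemma time_spent_mono: "a \<le> s \<Longrightarrow> time_spent P k a \<le> time_spent P k s"
  by (simp add: time_spent_def min_def max_def)

lemma displacement_sums:
  assumes "valid_program P" "0 \<le> s"
  shows "(\<lambda>k. time_spent P k s *\<^sub>R velocity (nth_instruction P k)) sums displacement P s"
  unfolding displacement_def using summable_displacement[OF assms] by (rule summable_sums)

text \<open>The displacement between \<open>a\<close> and \<open>s\<close> is a series of velocities
  weighted by durations \<open>w k\<close> of total at most \<open>s - a\<close>. Every velocity has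
  component \<open>c k < 1\<close> along \<open>u\<close>, so a single positive weight makes the
  total loss strict, although the \<open>c k\<close> may approach 1.\<close>

lemma progress_less_nonneg:
  assumes P: "valid_program P" and u: "norm u = 1"
    and dir: "u \<notin> range (\<lambda>k. velocity (nth_instruction P k))"
    and a: "0 \<le> a" "a < s"
  shows "(displacement P s - displacement P a) \<bullet> u < s - a"
proof -
  define w where "w k = time_spent P k s - time_spent P k a" for k
  define c where "c k = velocity (nth_instruction P k) \<bullet> u" for k
  have w0: "0 \<le> w k" for k using time_spent_mono[of a s P k] a by (simp add: w_def)
  have c1: "c k < 1" for k
    unfolding c_def using dir by (intro inner_less_one u norm_velocity_le) auto
  have bound: "(\<Sum>k<n. w k) \<le> s - a" for n
    using a by (simp add: w_def sum_subtractf sum_time_spent[OF P] min_def)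
  have sw: "summable w"
    using w0 bound[of "Suc _"] unfolding lessThan_Suc_atMost
    by (rule bounded_imp_summable[where B = "s - a"])
  have total: "suminf w \<le> s - a"
    using bound by (rule suminf_le_const[OF sw])
  have "(\<lambda>k. time_spent P k s *\<^sub>R velocity (nth_instruction P k)
           - time_spent P k a *\<^sub>R velocity (nth_instruction P k))
        sums (displacement P s - displacement P a)"
    using a by (intro sums_diff displacement_sums P) auto
  from bounded_linear.sums[OF bounded_linear_inner_left this, of u]
  have f: "(\<lambda>k. w k * c k) sums ((displacement P s - displacement P a) \<bullet> u)"
    by (simp add: w_def c_def inner_simps algebra_simps)
  show ?thesis
  proof (cases "\<exists>j. w j > 0")
    case True
    then obtain j where j: "w j > 0" ..
    have d: "(\<lambda>k. w k - w k * c k) sums (suminf w - (displacement P s - displacement P a) \<bullet> u)"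
      by (intro sums_diff f summable_sums sw)
    have nonneg: "0 \<le> w k - w k * c k" for k
      using w0[of k] c1[of k] by (simp add: mult_left_le)
    have "0 < w j - w j * c j" using j c1[of j] by simp
    then have "0 < (\<Sum>k. w k - w k * c k)"
      using suminf_pos2[OF sums_summable[OF d]] nonneg by blast
    then show ?thesis using total sums_unique[OF d] by simp
  next
    \<comment> \<open>No time is spent on any instruction: the whole program has run out by time
      \<open>a\<close>, and the agent stands still.\<close>
    case False
    then have "w k = 0" for k using w0[of k] by (metis less_eq_real_def)
    then have "(displacement P s - displacement P a) \<bullet> u = 0"
      using f by (simp add: sums_iff)
    then show ?thesis using a by simp
  qed
qed

text \<open>Negative times are needed because B's private clock is negative before its
  wake-up.\<close>

lemma progress_less:
  assumes P: "valid_program P" and u: "norm u = 1"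
    and dir: "u \<notin> range (\<lambda>k. velocity (nth_instruction P k))"
    and a: "a < s"
  shows "(displacement P s - displacement P a) \<bullet> u < s - a"
proof (cases "0 \<le> a")
  case True
  then show ?thesis using progress_less_nonneg[OF P u dir] a by blast
next
  case False
  then have a0: "displacement P a = 0" "displacement P 0 = 0"
    using displacement_nonpos[OF P] by simp_all
  show ?thesis
  proof (cases "0 < s")
    case True
    then show ?thesis using progress_less_nonneg[OF P u dir, of 0 s] a0 False by simp
  next
    case False
    then show ?thesis using displacement_nonpos[OF P, of s] a0 a by simp
  qed
qed

text \<open>The half circle is uncountable, and restricting to it keeps the doubled angle
  \<open>2 * \<theta>\<close> below \<open>2 * pi\<close>.\<close>

lemma cis_avoiding_countable:
  assumes "countable V"
  obtains \<theta> where "0 \<le> \<theta>" "\<theta> < pi" "cis \<theta> \<notin> V"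
proof -
  have "inj_on cis {0..<pi}"
  proof (rule inj_onI)
    fix x y :: real
    assume "x \<in> {0..<pi}" "y \<in> {0..<pi}" "cis x = cis y"
    moreover from this have "cos x = cos y" by (metis cis.sel(1))
    ultimately show "x = y" using cos_inj_pi[of x y] by auto
  qed
  moreover have "uncountable {0..<pi}"
    by (simp add: uncountable_half_open_interval_1)
  ultimately have "\<not> cis ` {0..<pi} \<subseteq> V"
    using countable_subset[OF _ assms] countable_image_inj_eq by metis
  then show ?thesis using that by (metis atLeastLessThan_iff image_subsetI)
qed

text \<open>With angle \<open>2 * \<theta>\<close> and chirality -1, B's frame is the mirror image
  of A's in the line of direction \<open>\<theta>\<close>; a reflection preserves the component
  along its axis.\<close>

lemma inner_mirrored:
  "(Re z *\<^sub>R cis (2 * \<theta>) + Im z *\<^sub>R cis (2 * \<theta> - pi / 2)) \<bullet> cis \<theta> = z \<bullet> cis \<theta>"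
proof -
  have cis_inner: "cis \<alpha> \<bullet> cis \<beta> = cos (\<alpha> - \<beta>)" for \<alpha> \<beta>
    by (simp add: inner_complex_def cos_diff)
  have "cos (2 * \<theta> - pi / 2 - \<theta>) = sin \<theta>"
    using cos_diff[of \<theta> "pi / 2"] by (simp add: algebra_simps)
  then show ?thesis
    by (simp add: inner_add_left cis_inner) (simp add: inner_complex_def)
qed

text \<open>If the search programs alone never bring the agents within the radius, neither agent
  ever switches to a reaction, so the actual trajectories are the search trajectories.\<close>

lemma no_rendezvous_if_never_close:
  assumes "0 \<le> wakeup I"
    and far: "\<And>s. 0 \<le> s \<Longrightarrow> radius I < dist (position_A alg None s) (position_B I alg None s)"
  shows "\<not> rendezvous alg I"
proof -
  have A: "sensing_A I alg = None"
    using far by (force simp: sensing_A_def first_time_def)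
  have "{s. wakeup I \<le> s \<and> dist (position_A alg None s) (position_B I alg None s) \<le> radius I} = {}"
    using far assms(1) by (smt (verit) empty_Collect_eq)
  then have B: "sensing_B I alg = None"
    by (simp add: sensing_B_def first_time_def A)
  show ?thesis
    unfolding rendezvous_def trajectory_A_def trajectory_B_def A B using far by (meson not_le)
qed

theorem theorem4p1:
  "\<not> (\<exists>alg. valid_algorithm alg \<and>
        (\<forall>I. valid_instance I \<and> synchronous I \<and> chirality I = -1 \<and>
             wakeup I = dist (proj_A I) (proj_B I) - radius I
          \<longrightarrow> rendezvous alg I))"
proof clarify
  fix alg
  assume "valid_algorithm alg"
    and all: "\<forall>I. valid_instance I \<and> synchronous I \<and> chirality I = -1 \<and>
             wakeup I = dist (proj_A I) (proj_B I) - radius I \<longrightarrow> rendezvous alg I"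
  then have P: "valid_program (search alg)" by (simp add: valid_algorithm_def)
  obtain \<theta> where \<theta>: "0 \<le> \<theta>" "\<theta> < pi"
    and dir: "cis \<theta> \<notin> range (\<lambda>k. velocity (nth_instruction (search alg) k))"
    by (rule cis_avoiding_countable[of "range (\<lambda>k. velocity (nth_instruction (search alg) k))"])
      auto
  \<comment> \<open>B starts at distance 2 from A in direction \<open>\<theta>\<close>, so the
    canonical line contains both start points. They are their own projections, and the required
    delay is 2 - 1 = 1.\<close>
  define I where "I = \<lparr>radius = 1, init_x = 2 * cos \<theta>, init_y = 2 * sin \<theta>, angle = 2 * \<theta>,
    time_unit = 1, speed = 1, wakeup = 1, chirality = -1\<rparr>"
  have b: "init_B I = 2 *\<^sub>R cis \<theta>"
    by (simp add: I_def init_B_def complex_eq_iff)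
  have uu: "cis \<theta> \<bullet> cis \<theta> = 1"
    by (simp add: dot_square_norm)
  have m: "midpoint 0 (2 *\<^sub>R cis \<theta>) = cis \<theta>" by (simp add: midpoint_def)
  have angle: "angle I / 2 = \<theta>" by (simp add: I_def)
  have "proj_A I = 0" "proj_B I = 2 *\<^sub>R cis \<theta>"
    unfolding proj_A_def proj_B_def orthogonal_projection_canonical_line b m angle
    by (simp_all add: uu inner_simps scaleR_2)
  moreover have "(cos \<theta>, sin \<theta>) \<noteq> (0, 0)"
    using sin_zero_abs_cos_one by fastforce
  ultimately have "rendezvous alg I"
    using \<theta> by (intro all[rule_format]) (auto simp: I_def valid_instance_def synchronous_def)
  moreover have "\<not> rendezvous alg I"
  proof (rule no_rendezvous_if_never_close)
    fix s :: real
    let ?z = "displacement (search alg)"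
    have "position_B I alg None s = 2 *\<^sub>R cis \<theta> +
        (Re (?z (s - 1)) *\<^sub>R cis (2 * \<theta>) + Im (?z (s - 1)) *\<^sub>R cis (2 * \<theta> - pi / 2))"
      unfolding position_B_def b by (simp add: I_def private_time_B_def Let_def)
    \<comment> \<open>Already the component along the line exceeds the radius: it is 2 minus A's
      progress during one time unit, which is below 1.\<close>
    then have "(position_B I alg None s - position_A alg None s) \<bullet> cis \<theta> =
        2 - (?z s - ?z (s - 1)) \<bullet> cis \<theta>"
      using inner_mirrored[of "?z (s - 1)" \<theta>]
      by (simp add: position_A_def inner_add_left inner_diff_left uu)
    moreover have "(?z s - ?z (s - 1)) \<bullet> cis \<theta> < s - (s - 1)"
      by (intro progress_less P dir) auto
    moreover have "(position_B I alg None s - position_A alg None s) \<bullet> cis \<theta>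
        \<le> norm (position_B I alg None s - position_A alg None s)"
      using norm_cauchy_schwarz[of "position_B I alg None s - position_A alg None s" "cis \<theta>"]
      by simp
    ultimately show "radius I < dist (position_A alg None s) (position_B I alg None s)"
      by (simp add: I_def dist_norm norm_minus_commute)
  qed (simp add: I_def)
  ultimately show False by simp
qed

end
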